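(* Let $0<L<1$ and let $K=\frac{4-L}{1-L}>4$. Let $u^n\in\ell^2(\mathbb{Z})$ be a grid function, and consider the iteration $$w^0=u^n,\qquad w^{\ell+1}=u^n-\Delta t\,\mathbb{G}\Big(\frac{u^n+w^\ell}{2}\Big)-\Delta t\,D_-DD_+\Big(\frac{u^n+w^{\ell+1}}{2}\Big),\quad \ell\ge0.$$ Assume that the CFL condition $$\lambda\le\frac{L}{K\|u^n\|_{h^3}},\qquad \lambda=\frac{\Delta t}{\Delta x},$$ is satisfied. Then there exists a function $u^{n+1}$ that solves $$u_j^{n+1} = u_j^n -\Delta t\, \tilde{u}_j^{n+1/2}\, Du_j^{n+1/2} - \Delta t\, D_-DD_+u^{n+1/2}_j,\qquad j\in\mathbb{Z},$$ and $\lim_{\ell\to\infty}w^\ell=u^{n+1}$. Moreover, $\|u^{n+1}\|_{h^3}\le K\|u^n\|_{h^3}$.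
   Context: Grid spacing $\Delta x>0$, time step $\Delta t>0$, $x_j=j\Delta x$, $j\in\mathbb{Z}$. For a grid function $v=(v_j)$: $D_+v_j=(v_{j+1}-v_j)/\Delta x$, $D_-v_j=(v_j-v_{j-1})/\Delta x$, $D=\frac12(D_++D_-)$, $\tilde v_j=\frac13(v_{j+1}+v_j+v_{j-1})$, $\mathbb{G}(v)=\tilde v\,Dv$, $\|v\|=(\Delta x\sum_jv_j^2)^{1/2}$, $\|v\|_{h^3}=\|v\|+\|D_+v\|+\|D_+D_-v\|+\|D_-DD_+v\|$. Also $u^{n+1/2}=\frac12(u^n+u^{n+1})$. The limit is in the $h^3$ norm (equivalent to the $\ell^2$ norm for fixed $\Delta x$). *)

theory Defs
  imports "HOL-Analysis.Analysis"
begin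

type_synonym grid_fun = "int \<Rightarrow> real"

definition Dplus :: "real \<Rightarrow> grid_fun \<Rightarrow> grid_fun" where
  "Dplus dx v = (\<lambda>j. (v (j + 1) - v j) / dx)"

definition Dminus :: "real \<Rightarrow> grid_fun \<Rightarrow> grid_fun" where
  "Dminus dx v = (\<lambda>j. (v j - v (j - 1)) / dx)"

definition Dcent :: "real \<Rightarrow> grid_fun \<Rightarrow> grid_fun" where
  "Dcent dx v = (\<lambda>j. (Dplus dx v j + Dminus dx v j) / 2)"

definition tilde :: "grid_fun \<Rightarrow> grid_fun" where
  "tilde v = (\<lambda>j. (v (j + 1) + v j + v (j - 1)) / 3)"

definition Gop :: "real \<Rightarrow> grid_fun \<Rightarrow> grid_fun" where
  "Gop dx v = (\<lambda>j. tilde v j * Dcent dx v j)"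

definition ell2 :: "grid_fun set" where
  "ell2 = {v. (\<lambda>j. (v j)\<^sup>2) summable_on UNIV}"

text \<open>The norms below are meaningful only on \<^term>\<open>ell2\<close>: off it the infinite sum
  defaults to 0.\<close>

definition l2norm :: "real \<Rightarrow> grid_fun \<Rightarrow> real" where
  "l2norm dx v = sqrt (dx * (\<Sum>\<^sub>\<infinity>j. (v j)\<^sup>2))"

definition h3norm :: "real \<Rightarrow> grid_fun \<Rightarrow> real" where
  "h3norm dx v = l2norm dx v + l2norm dx (Dplus dx v) + l2norm dx (Dplus dx (Dminus dx v))
     + l2norm dx (Dminus dx (Dcent dx (Dplus dx v)))"

definition half :: "grid_fun \<Rightarrow> grid_fun \<Rightarrow> grid_fun" where
  "half u v = (\<lambda>j. (u j + v j) / 2)"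

text \<open>Each step is an implicit linear equation, which has further solutions outside
  \<^term>\<open>ell2\<close> (the stencil has a nontrivial kernel on all grid functions); membership in
  \<^term>\<open>ell2\<close> is therefore part of what it means to be the sequence of iterates.\<close>

definition iterates :: "real \<Rightarrow> real \<Rightarrow> grid_fun \<Rightarrow> (nat \<Rightarrow> grid_fun) \<Rightarrow> bool" where
  "iterates dx dt u w \<longleftrightarrow>
     w 0 = u \<and> (\<forall>l. w l \<in> ell2) \<and>
     (\<forall>l j. w (Suc l) j = u j - dt * Gop dx (half u (w l)) j
        - dt * Dminus dx (Dcent dx (Dplus dx (half u (w (Suc l))))) j)"

definition solves_scheme :: "real \<Rightarrow> real \<Rightarrow> grid_fun \<Rightarrow> grid_fun \<Rightarrow> bool" where
  "solves_scheme dx dt u u' \<longleftrightarrow>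
     (\<forall>j. u' j = u j - dt * (tilde (half u u') j * Dcent dx (half u u') j)
        - dt * Dminus dx (Dcent dx (Dplus dx (half u u'))) j)"

end

theory Submission
  imports Defs
begin

text \<open>
  Write \<open>\<parallel>\<cdot>\<parallel>\<close> for the \<open>h\<^sup>3\<close> norm, \<open>Z = \<parallel>u\<parallel>\<close> for the norm of the data and \<open>T = (\<Delta>t/2) D\<^sub>-DD\<^sub>+\<close>. One step of
  the iteration sends \<open>y\<close> to the solution \<open>w\<close> of \<open>w + T w = u - T u - \<Delta>t \<G>((u + y)/2)\<close>. Three facts
  make this map a contraction of the ball of radius \<open>3 Z\<close> into itself, and its fixed point is
  the new time level.

  First, \<open>T\<close> is skew. On square summable functions this makes \<open>I + T\<close> bijective
  (\<open>skew_perturbation_bijective\<close>), so the iterates exist and are unique, and an energy estimate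
  gives \<open>\<parallel>w\<parallel> \<le> Z + \<Delta>t \<parallel>\<G>((u + y)/2)\<parallel>\<close> (\<open>h3_energy_estimate\<close>); it passes from the square norm to
  the \<open>h\<^sup>3\<close> norm because \<open>T\<close> commutes with all differences. No power of \<open>1/\<Delta>x\<close> is lost to the
  third order term.

  Second, the discrete Sobolev inequality \<open>sup \<bar>v\<bar> \<le> (\<parallel>v\<parallel>\<^sub>0 + \<parallel>D\<^sub>+v\<parallel>\<^sub>0)/2\<close>, with \<open>\<parallel>\<cdot>\<parallel>\<^sub>0\<close> the weighted
  square norm, and the discrete Leibniz rules make the \<open>h\<^sup>3\<close> functions a Banach algebra:
  \<open>\<parallel>a b\<parallel> \<le> 4 \<parallel>a\<parallel> \<parallel>b\<parallel>\<close> (\<open>h3_times_le\<close>). Since the averaging does not increase the norm and the central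
  difference costs a factor \<open>1/\<Delta>x\<close>, the nonlinearity satisfies
  \<open>\<parallel>\<G>(x) - \<G>(y)\<parallel> \<le> (4/\<Delta>x) (\<parallel>x\<parallel> + \<parallel>y\<parallel>) \<parallel>x - y\<parallel>\<close>.

  Third, the CFL condition bounds \<open>\<lambda> Z\<close> by \<open>L/K = L (1 - L)/(4 - L) \<le> 1/12\<close>. For \<open>\<parallel>y\<parallel> \<le> 3 Z\<close> the
  midpoint has norm at most \<open>2 Z\<close>, so the step has norm at most
  \<open>Z + 4 \<lambda> (2 Z)\<^sup>2 \<le> Z + (4/3) Z \<le> 3 Z\<close>, and its Lipschitz constant is at most \<open>4 \<lambda> (4 Z)/2 \<le> 2/3\<close>.
  The iterates are therefore Cauchy; since the \<open>h\<^sup>3\<close> norm is equivalent to the norm of the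
  complete space of square summable functions for fixed \<open>\<Delta>x\<close>, they converge, and as the
  equation involves finitely many grid values at each point, the limit solves the scheme.
  Its norm is at most \<open>3 Z\<close>, and \<open>3 \<le> K\<close>.
\<close>

section \<open>The Hilbert space of square summable functions\<close>

lemma abs_mult_le_sum_squares: "\<bar>a * b\<bar> \<le> a\<^sup>2 + (b::real)\<^sup>2"
proof -
  have "0 \<le> (\<bar>a\<bar> - \<bar>b\<bar>)\<^sup>2" by simp
  then have "2 * \<bar>a * b\<bar> \<le> a\<^sup>2 + b\<^sup>2"
    by (simp add: power2_diff abs_mult)
  then show ?thesis by simp
qed

lemma square_summable_mult:
  fixes v w :: "'a \<Rightarrow> real"
  assumes "(\<lambda>j. (v j)\<^sup>2) summable_on UNIV" "(\<lambda>j. (w j)\<^sup>2) summable_on UNIV"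
  shows "(\<lambda>j. v j * w j) summable_on UNIV"
proof -
  have "(\<lambda>j. norm (v j * w j)) summable_on UNIV"
  proof (rule summable_on_comparison_test)
    show "(\<lambda>j. (v j)\<^sup>2 + (w j)\<^sup>2) summable_on UNIV"
      using assms by (rule summable_on_add)
  qed (simp_all add: abs_mult_le_sum_squares)
  then show ?thesis by (rule abs_summable_summable)
qed

lemma square_summable_add:
  fixes v w :: "'a \<Rightarrow> real"
  assumes "(\<lambda>j. (v j)\<^sup>2) summable_on UNIV" "(\<lambda>j. (w j)\<^sup>2) summable_on UNIV"
  shows "(\<lambda>j. (v j + w j)\<^sup>2) summable_on UNIV"
proof -
  have "(\<lambda>j. (v j)\<^sup>2 + (w j)\<^sup>2 + 2 * (v j * w j)) summable_on UNIV"
    by (intro summable_on_add summable_on_cmult_right square_summable_mult assms)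
  then show ?thesis by (simp add: power2_sum algebra_simps)
qed

lemma square_summable_scale:
  fixes v :: "'a \<Rightarrow> real"
  assumes "(\<lambda>j. (v j)\<^sup>2) summable_on UNIV"
  shows "(\<lambda>j. (c * v j)\<^sup>2) summable_on UNIV"
  using summable_on_cmult_right[OF assms, of "c\<^sup>2"] by (simp add: power_mult_distrib)

typedef 'a l2 = "{v :: 'a \<Rightarrow> real. (\<lambda>j. (v j)\<^sup>2) summable_on UNIV}"
  morphisms coord l2_of
  by (rule exI[of _ "\<lambda>_. 0"]) simp

lemma square_summable_coord: "(\<lambda>j. (coord x j)\<^sup>2) summable_on UNIV"
  using coord[of x] by simp

lemma coord_l2_of: "(\<lambda>j. (v j)\<^sup>2) summable_on UNIV \<Longrightarrow> coord (l2_of v) = v"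
  by (rule l2_of_inverse) simp

lemma l2_eqI: "(\<And>j. coord x j = coord y j) \<Longrightarrow> x = y"
  by (simp add: coord_inject[symmetric] fun_eq_iff)

lemma coord_mult_summable: "(\<lambda>j. coord x j * coord y j) summable_on UNIV"
  by (intro square_summable_mult square_summable_coord)

text \<open>The inner product carries no weight \<open>\<Delta>x\<close>, so that a single type serves all grids; the weight
  enters as a factor \<open>\<surd>\<Delta>x\<close> in the norms below.\<close>

instantiation l2 :: (type) real_inner
begin

definition zero_l2 :: "'a l2" where "0 = l2_of (\<lambda>_. 0)"
definition plus_l2 :: "'a l2 \<Rightarrow> 'a l2 \<Rightarrow> 'a l2" where
  "x + y = l2_of (\<lambda>j. coord x j + coord y j)"
definition scaleR_l2 :: "real \<Rightarrow> 'a l2 \<Rightarrow> 'a l2" where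
  "c *\<^sub>R x = l2_of (\<lambda>j. c * coord x j)"
definition uminus_l2 :: "'a l2 \<Rightarrow> 'a l2" where "- x = (-1) *\<^sub>R (x :: 'a l2)"
definition minus_l2 :: "'a l2 \<Rightarrow> 'a l2 \<Rightarrow> 'a l2" where "x - y = x + - (y :: 'a l2)"
definition inner_l2 :: "'a l2 \<Rightarrow> 'a l2 \<Rightarrow> real" where
  "inner x y = (\<Sum>\<^sub>\<infinity>j. coord x j * coord y j)"
definition norm_l2 :: "'a l2 \<Rightarrow> real" where "norm x = sqrt (inner x (x :: 'a l2))"
definition sgn_l2 :: "'a l2 \<Rightarrow> 'a l2" where "sgn x = inverse (norm x) *\<^sub>R (x :: 'a l2)"
definition dist_l2 :: "'a l2 \<Rightarrow> 'a l2 \<Rightarrow> real" where "dist x y = norm (x - y :: 'a l2)"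
definition uniformity_l2 :: "('a l2 \<times> 'a l2) filter" where
  "uniformity_l2 = (INF e\<in>{0<..}. principal {(x, y). dist x (y :: 'a l2) < e})"
definition open_l2 :: "'a l2 set \<Rightarrow> bool" where
  "open_l2 U \<longleftrightarrow> (\<forall>x\<in>U. \<forall>\<^sub>F (x', y) in uniformity. x' = x \<longrightarrow> (y :: 'a l2) \<in> U)"

lemma coord_zero [simp]: "coord 0 j = 0"
  and coord_add [simp]: "coord (x + y) j = coord x j + coord y j"
  and coord_scaleR [simp]: "coord (c *\<^sub>R x) j = c * coord x j"
  by (simp_all add: zero_l2_def plus_l2_def scaleR_l2_def coord_l2_of square_summable_coord
      square_summable_add square_summable_scale)

lemma coord_minus [simp]: "coord (- x) j = - coord x j"
  by (simp add: uminus_l2_def)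

lemma coord_diff [simp]: "coord (x - y) j = coord x j - coord y j"
  by (simp add: minus_l2_def)

instance
proof
  fix x y z :: "'a l2" and c d :: real
  show "x + y + z = x + (y + z)" "x + y = y + x" "0 + x = x" "- x + x = 0" "x - y = x + - y"
    "c *\<^sub>R (x + y) = c *\<^sub>R x + c *\<^sub>R y" "(c + d) *\<^sub>R x = c *\<^sub>R x + d *\<^sub>R x"
    "c *\<^sub>R d *\<^sub>R x = (c * d) *\<^sub>R x" "1 *\<^sub>R x = x"
    by (auto intro!: l2_eqI simp: algebra_simps)
  show "inner x y = inner y x"
    by (simp add: inner_l2_def mult.commute)
  show "inner (x + y) z = inner x z + inner y z"
    by (simp add: inner_l2_def distrib_right infsum_add coord_mult_summable)
  show "inner (c *\<^sub>R x) y = c * inner x y"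
    by (simp add: inner_l2_def mult.assoc infsum_cmult_right coord_mult_summable)
  show "0 \<le> inner x x"
    by (simp add: inner_l2_def infsum_nonneg)
  show "inner x x = 0 \<longleftrightarrow> x = 0"
  proof
    assume eq: "inner x x = 0"
    have "coord x j * coord x j = 0" for j
      by (rule nonneg_infsum_le_0D[where A=UNIV, OF _ coord_mult_summable])
        (use eq in \<open>auto simp: inner_l2_def\<close>)
    then show "x = 0" by (intro l2_eqI) simp
  qed (simp add: inner_l2_def)
qed (simp_all add: norm_l2_def sgn_l2_def dist_l2_def uniformity_l2_def open_l2_def)

end

lemma norm_l2_sq: "(norm x)\<^sup>2 = (\<Sum>\<^sub>\<infinity>j. (coord x j)\<^sup>2)"
  unfolding power2_norm_eq_inner by (simp add: inner_l2_def power2_eq_square)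

lemma sum_coord_sq_le: "finite F \<Longrightarrow> (\<Sum>j\<in>F. (coord x j)\<^sup>2) \<le> (norm x)\<^sup>2"
  unfolding norm_l2_sq by (rule finite_sum_le_infsum[OF square_summable_coord]) auto

lemma abs_coord_le_norm: "\<bar>coord x j\<bar> \<le> norm x"
  using sum_coord_sq_le[of "{j}" x] by (simp add: abs_le_square_iff[of _ "norm x", simplified])

text \<open>For pointwise limits and for products, membership in the space has to be obtained together
  with the norm bound, from finite sums alone.\<close>

lemma l2_of_bounded:
  fixes v :: "'a \<Rightarrow> real"
  assumes "\<And>F. finite F \<Longrightarrow> (\<Sum>j\<in>F. (v j)\<^sup>2) \<le> c\<^sup>2" and "0 \<le> c"
  shows "coord (l2_of v) = v" and "norm (l2_of v) \<le> c"
proof -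
  have v: "(\<lambda>j. (v j)\<^sup>2) summable_on UNIV"
    by (rule nonneg_bdd_above_summable_on) (auto intro!: bdd_aboveI2[where M="c\<^sup>2"] assms)
  then show 1: "coord (l2_of v) = v" by (rule coord_l2_of)
  have "(norm (l2_of v))\<^sup>2 \<le> c\<^sup>2"
    unfolding norm_l2_sq 1 by (rule infsum_le_finite_sums[OF v]) (rule assms)
  then show "norm (l2_of v) \<le> c"
    using assms(2) by (rule power2_le_imp_le)
qed

instance l2 :: (type) complete_space
proof
  fix X :: "nat \<Rightarrow> 'a l2"
  assume X: "Cauchy X"
  have "Cauchy (\<lambda>n. coord (X n) j)" for j
  proof (rule metric_CauchyI)
    fix e :: real assume "0 < e"
    then obtain N where "\<forall>m\<ge>N. \<forall>n\<ge>N. dist (X m) (X n) < e"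
      using metric_CauchyD[OF X] by blast
    moreover have "dist (coord (X m) j) (coord (X n) j) \<le> dist (X m) (X n)" for m n
      using abs_coord_le_norm[of "X m - X n" j] by (simp add: dist_norm)
    ultimately show "\<exists>M. \<forall>m\<ge>M. \<forall>n\<ge>M. dist (coord (X m) j) (coord (X n) j) < e"
      by (meson le_less_trans)
  qed
  then obtain v where v: "\<And>j. (\<lambda>n. coord (X n) j) \<longlonglongrightarrow> v j"
    unfolding Cauchy_convergent_iff convergent_def by metis
  have tail: "(\<Sum>j\<in>F. (coord (X n) j - v j)\<^sup>2) \<le> e\<^sup>2"
    if N: "\<forall>m\<ge>N. \<forall>n\<ge>N. dist (X m) (X n) < e" and "N \<le> n" for e N n F
  proof (rule tendsto_upperbound)
    show "(\<lambda>m. \<Sum>j\<in>F. (coord (X n) j - coord (X m) j)\<^sup>2) \<longlonglongrightarrow> (\<Sum>j\<in>F. (coord (X n) j - v j)\<^sup>2)"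
      by (intro tendsto_intros v)
    have "(\<Sum>j\<in>F. (coord (X n) j - coord (X m) j)\<^sup>2) \<le> e\<^sup>2" if "N \<le> m" for m
    proof (cases "finite F")
      case True
      have "(\<Sum>j\<in>F. (coord (X n) j - coord (X m) j)\<^sup>2) \<le> (norm (X n - X m))\<^sup>2"
        using sum_coord_sq_le[OF True, of "X n - X m"] by simp
      also have "\<dots> \<le> e\<^sup>2"
        using N \<open>N \<le> n\<close> that by (intro power_mono) (auto simp: dist_norm less_imp_le)
      finally show ?thesis .
    qed simp
    then show "\<forall>\<^sub>F m in sequentially. (\<Sum>j\<in>F. (coord (X n) j - coord (X m) j)\<^sup>2) \<le> e\<^sup>2"
      using eventually_sequentially by blast
  qed simp
  define d where "d n = l2_of (\<lambda>j. coord (X n) j - v j)" for n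
  have near: "\<exists>N. \<forall>n\<ge>N. coord (d n) = (\<lambda>j. coord (X n) j - v j) \<and> norm (d n) \<le> e" if "0 < e" for e
  proof -
    obtain N where N: "\<forall>m\<ge>N. \<forall>n\<ge>N. dist (X m) (X n) < e"
      using metric_CauchyD[OF X \<open>0 < e\<close>] by blast
    have "coord (d n) = (\<lambda>j. coord (X n) j - v j) \<and> norm (d n) \<le> e" if "N \<le> n" for n
      unfolding d_def using that \<open>0 < e\<close>
      by (intro conjI l2_of_bounded[of "\<lambda>j. coord (X n) j - v j" e] tail[OF N]) auto
    then show ?thesis by (intro exI allI impI)
  qed
  obtain N where N: "coord (d N) = (\<lambda>j. coord (X N) j - v j)"
    using near[OF zero_less_one] order_refl by metis
  have "X \<longlonglongrightarrow> X N - d N"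
  proof (rule metric_LIMSEQ_I)
    fix e :: real assume "0 < e"
    obtain M where M: "coord (d n) = (\<lambda>j. coord (X n) j - v j)" "norm (d n) \<le> e / 2" if "M \<le> n" for n
      using near[OF half_gt_zero[OF \<open>0 < e\<close>]] by metis
    have "dist (X n) (X N - d N) < e" if "M \<le> n" for n
    proof -
      have "X n - (X N - d N) = d n" by (rule l2_eqI) (simp add: M(1)[OF that] N)
      then show ?thesis using M(2)[OF that] \<open>0 < e\<close> by (simp add: dist_norm)
    qed
    then show "\<exists>M. \<forall>n\<ge>M. dist (X n) (X N - d N) < e" by (intro exI allI impI)
  qed
  then show "convergent X" by (rule convergentI)
qed

instance l2 :: (type) banach ..

section \<open>Skew perturbations of the identity\<close>

text \<open>One Richardson step for \<^term>\<open>w + T w = f\<close> with relaxation parameter \<open>r\<close> multiplies the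
  squared distance by at most \<open>(1 - r)\<^sup>2 + r\<^sup>2 M\<^sup>2\<close>, because the cross term vanishes for skew \<open>T\<close>. With
  \<open>r = 1 / (1 + M\<^sup>2)\<close> this is \<open>1 - r\<close>, so the step is a contraction however large \<open>M\<close> is.\<close>

lemma skew_perturbation_bijective:
  fixes T :: "'a::{real_inner,banach} \<Rightarrow> 'a"
  assumes "linear T" and skew: "\<And>x. inner (T x) x = 0" and bound: "\<And>x. norm (T x) \<le> M * norm x"
  shows "\<exists>!w. w + T w = f"
proof -
  define r where "r = 1 / (1 + M\<^sup>2)"
  have pos: "0 < 1 + M\<^sup>2" by (simp add: add_pos_nonneg)
  have r: "0 < r" "r \<le> 1" "r * (1 + M\<^sup>2) = 1"
    using pos by (auto simp: r_def)
  define S where "S w = w - r *\<^sub>R (w + T w - f)" for w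
  have contr: "norm (S x - S y) \<le> sqrt (1 - r) * norm (x - y)" for x y
  proof -
    define z where "z = x - y"
    have z: "S x - S y = (1 - r) *\<^sub>R z - r *\<^sub>R T z"
      unfolding S_def z_def linear_diff[OF \<open>linear T\<close>] by (simp add: algebra_simps)
    have "(norm (S x - S y))\<^sup>2 = (1 - r)\<^sup>2 * (norm z)\<^sup>2 + r\<^sup>2 * (norm (T z))\<^sup>2"
      unfolding z power2_norm_eq_inner using skew[of z]
      by (simp add: inner_diff inner_commute[of z "T z"] power2_eq_square)
    also have "\<dots> \<le> (1 - r)\<^sup>2 * (norm z)\<^sup>2 + r\<^sup>2 * (M * norm z)\<^sup>2"
      by (intro add_left_mono mult_left_mono power_mono bound) auto
    also have "(1 - r)\<^sup>2 * (norm z)\<^sup>2 + r\<^sup>2 * (M * norm z)\<^sup>2 = ((1 - r)\<^sup>2 + r\<^sup>2 * M\<^sup>2) * (norm z)\<^sup>2"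
      by (simp add: power_mult_distrib distrib_right)
    also have "(1 - r)\<^sup>2 + r\<^sup>2 * M\<^sup>2 = 1 - 2 * r + r * (r * (1 + M\<^sup>2))"
      by (simp add: power2_diff power2_eq_square algebra_simps)
    also have "\<dots> = 1 - r"
      by (simp add: r(3))
    also have "(1 - r) * (norm z)\<^sup>2 = (sqrt (1 - r) * norm z)\<^sup>2"
      using r(2) by (simp add: power_mult_distrib)
    finally have "norm (S x - S y) \<le> sqrt (1 - r) * norm z"
      by (rule power2_le_imp_le) (use r(2) in auto)
    then show ?thesis by (simp only: z_def)
  qed
  have "\<exists>!w. S w = w"
    using r(1,2) contr by (intro banach_fix_type[of "sqrt (1 - r)"]) (auto simp: dist_norm)
  moreover have "S w = w \<longleftrightarrow> w + T w = f" for w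
    using r(1) by (simp add: S_def)
  ultimately show ?thesis by simp
qed

text \<open>The energy identity of the trapezoidal rule: testing the equation with \<^term>\<open>w + u\<close> makes the
  skew term disappear and leaves \<open>\<parallel>w\<parallel>\<^sup>2 - \<parallel>u\<parallel>\<^sup>2 = - \<langle>f, w + u\<rangle>\<close>.\<close>

lemma skew_energy_estimate:
  fixes T :: "'a::real_inner \<Rightarrow> 'a"
  assumes "linear T" and skew: "\<And>x. inner (T x) x = 0" and eq: "w + T w = u - T u - f"
  shows "norm w \<le> norm u + norm f"
proof (cases "norm w + norm u = 0")
  case False
  then have pos: "0 < norm w + norm u" by (smt (verit) norm_ge_zero)
  have "w - u = - T (w + u) - f"
    using eq unfolding linear_add[OF \<open>linear T\<close>] by (simp add: algebra_simps)
  then have "inner (w - u) (w + u) = - inner f (w + u)"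
    using skew[of "w + u"] by (simp add: inner_diff_left)
  also have "\<dots> \<le> norm f * norm (w + u)"
    using Cauchy_Schwarz_ineq2[of f "w + u"] by simp
  also have "\<dots> \<le> norm f * (norm w + norm u)"
    by (intro mult_left_mono norm_triangle_ineq) auto
  finally have "(norm w - norm u) * (norm w + norm u) \<le> norm f * (norm w + norm u)"
    by (simp add: inner_diff_left inner_add_right inner_commute dot_square_norm algebra_simps power2_eq_square)
  then show ?thesis using pos by simp
qed (smt (verit) norm_ge_zero)

section \<open>Pointwise products and the maximum norm\<close>

lemma norm_le_of_coord_le:
  assumes le: "\<And>j. \<bar>coord z j\<bar> \<le> c * \<bar>coord y j\<bar>" and "0 \<le> c"
  shows "norm z \<le> c * norm y"
proof -
  have "(\<Sum>j\<in>F. (coord z j)\<^sup>2) \<le> (c * norm y)\<^sup>2" if "finite F" for F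
  proof -
    have "(\<Sum>j\<in>F. (coord z j)\<^sup>2) \<le> (\<Sum>j\<in>F. c\<^sup>2 * (coord y j)\<^sup>2)"
    proof (rule sum_mono)
      fix j
      have "\<bar>coord z j\<bar>\<^sup>2 \<le> (c * \<bar>coord y j\<bar>)\<^sup>2"
        by (rule power_mono) (simp_all add: le)
      then show "(coord z j)\<^sup>2 \<le> c\<^sup>2 * (coord y j)\<^sup>2"
        by (simp add: power_mult_distrib)
    qed
    also have "\<dots> \<le> c\<^sup>2 * (norm y)\<^sup>2"
      unfolding sum_distrib_left[symmetric]
      by (intro mult_left_mono sum_coord_sq_le that) simp
    finally show ?thesis by (simp add: power_mult_distrib)
  qed
  from l2_of_bounded(2)[OF this] show ?thesis
    using \<open>0 \<le> c\<close> by (simp add: coord_inverse)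
qed

instantiation l2 :: (type) real_normed_algebra
begin

definition times_l2 :: "'a l2 \<Rightarrow> 'a l2 \<Rightarrow> 'a l2" where
  "x * y = l2_of (\<lambda>j. coord x j * coord y j)"

lemma coord_times [simp]: "coord (x * y) j = coord x j * coord y j"
proof -
  have "(\<lambda>j. (coord x j * coord y j)\<^sup>2) summable_on UNIV"
  proof (rule summable_on_comparison_test)
    show "(\<lambda>j. (norm x * coord y j)\<^sup>2) summable_on UNIV"
      by (rule square_summable_scale[OF square_summable_coord])
    show "(coord x j * coord y j)\<^sup>2 \<le> (norm x * coord y j)\<^sup>2" for j
      using mult_right_mono[OF abs_coord_le_norm[of x j], of "\<bar>coord y j\<bar>"]
      by (simp add: abs_le_square_iff[symmetric] abs_mult)
  qed simp
  then show ?thesis by (simp add: times_l2_def coord_l2_of)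
qed

instance
proof
  fix x y z :: "'a l2" and c :: real
  show "x * y * z = x * (y * z)" "(x + y) * z = x * z + y * z" "x * (y + z) = x * y + x * z"
    "c *\<^sub>R x * y = c *\<^sub>R (x * y)" "x * c *\<^sub>R y = c *\<^sub>R (x * y)"
    by (auto intro!: l2_eqI simp: algebra_simps)
  show "norm (x * y) \<le> norm x * norm y"
    by (rule norm_le_of_coord_le) (simp_all add: abs_mult mult_right_mono abs_coord_le_norm)
qed

end

lemma l2_mult_commute: "x * y = y * (x :: 'a l2)"
  by (rule l2_eqI) (simp add: mult.commute)

definition maxnorm :: "'a l2 \<Rightarrow> real" where
  "maxnorm x = (SUP j. \<bar>coord x j\<bar>)"

lemma abs_coord_le_maxnorm: "\<bar>coord x j\<bar> \<le> maxnorm x"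
  unfolding maxnorm_def
  by (rule cSUP_upper) (auto intro!: bdd_aboveI2[where M="norm x"] abs_coord_le_norm)

lemma maxnorm_le: "(\<And>j. \<bar>coord x j\<bar> \<le> c) \<Longrightarrow> maxnorm x \<le> c"
  unfolding maxnorm_def by (rule cSUP_least) auto

lemma maxnorm_nonneg: "0 \<le> maxnorm x"
  using abs_coord_le_maxnorm[of x undefined] by linarith

lemma norm_times_le_left: "norm (x * y) \<le> maxnorm x * norm y"
  by (rule norm_le_of_coord_le)
    (simp_all add: abs_mult mult_right_mono abs_coord_le_maxnorm maxnorm_nonneg)

lemma norm_times_le_right: "norm (x * y) \<le> maxnorm y * norm x"
  using norm_times_le_left[of y x] by (simp add: l2_mult_commute)

section \<open>Difference operators\<close>

definition shift :: "int \<Rightarrow> int l2 \<Rightarrow> int l2" where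
  "shift k x = l2_of (\<lambda>j. coord x (j + k))"

lemma bij_int_translate: "bij (\<lambda>j. j + (k::int))"
  by (rule bij_betw_byWitness[where f'="\<lambda>j. j - k"]) auto

lemma coord_shift [simp]: "coord (shift k x) j = coord x (j + k)"
  using summable_on_reindex_bij_betw[OF bij_int_translate, of "\<lambda>j. (coord x j)\<^sup>2" k]
  by (simp add: shift_def coord_l2_of square_summable_coord)

lemma inner_shift: "inner (shift k x) y = inner x (shift (- k) y)"
  using infsum_reindex_bij_betw[OF bij_int_translate, of "\<lambda>j. coord x j * coord y (j - k)" k]
  by (simp add: inner_l2_def)

lemma shift_shift: "shift k (shift l x) = shift (k + l) x"
  by (rule l2_eqI) (simp add: add.assoc)

lemma shift_zero: "shift 0 x = x"
  by (rule l2_eqI) simp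

lemma norm_shift [simp]: "norm (shift k x) = norm x"
  by (simp add: norm_eq_sqrt_inner inner_shift shift_shift shift_zero)

lemma maxnorm_shift [simp]: "maxnorm (shift k x) = maxnorm x"
  by (rule antisym; rule maxnorm_le)
    (metis coord_shift abs_coord_le_maxnorm diff_add_cancel)+

definition Dp :: "real \<Rightarrow> int l2 \<Rightarrow> int l2" where
  "Dp dx x = (shift 1 x - x) /\<^sub>R dx"

definition Dm :: "real \<Rightarrow> int l2 \<Rightarrow> int l2" where
  "Dm dx x = (x - shift (-1) x) /\<^sub>R dx"

definition Dc :: "real \<Rightarrow> int l2 \<Rightarrow> int l2" where
  "Dc dx x = (Dp dx x + Dm dx x) /\<^sub>R 2"

definition avg :: "int l2 \<Rightarrow> int l2" where
  "avg x = (shift 1 x + x + shift (-1) x) /\<^sub>R 3"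

abbreviation D3 :: "real \<Rightarrow> int l2 \<Rightarrow> int l2" where
  "D3 dx x \<equiv> Dm dx (Dc dx (Dp dx x))"

lemma coord_Dp: "coord (Dp dx x) = Dplus dx (coord x)"
  and coord_Dm: "coord (Dm dx x) = Dminus dx (coord x)"
  by (auto simp: Dp_def Dm_def Dplus_def Dminus_def divide_inverse_commute)

lemma coord_Dc: "coord (Dc dx x) = Dcent dx (coord x)"
  by (auto simp: Dc_def Dcent_def coord_Dp coord_Dm)

lemma coord_avg: "coord (avg x) = tilde (coord x)"
  by (auto simp: avg_def tilde_def)

lemmas stencil_simps = coord_Dp coord_Dm coord_Dc coord_avg Dplus_def Dminus_def Dcent_def tilde_def

lemma operators_commute:
  "Dm dx (Dp dx x) = Dp dx (Dm dx x)" "Dc dx (Dp dx x) = Dp dx (Dc dx x)"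
  "Dc dx (Dm dx x) = Dm dx (Dc dx x)"
  "avg (Dp dx x) = Dp dx (avg x)" "avg (Dm dx x) = Dm dx (avg x)" "avg (Dc dx x) = Dc dx (avg x)"
  by (auto intro!: l2_eqI simp: stencil_simps algebra_simps add_divide_distrib diff_divide_distrib)

lemma operators_linear: "linear (Dp dx)" "linear (Dm dx)" "linear (Dc dx)" "linear avg"
  by (auto intro!: linearI l2_eqI
      simp: stencil_simps algebra_simps add_divide_distrib diff_divide_distrib)

lemma linear_D3: "linear (D3 dx)"
  using linear_compose[OF linear_compose[OF operators_linear(1,3)] operators_linear(2)]
  by (simp add: o_def)

lemma inner_Dp: "inner (Dp dx x) y = - inner x (Dm dx y)"
  by (simp add: Dp_def Dm_def inner_diff inner_shift algebra_simps)

lemma inner_Dm: "inner (Dm dx x) y = - inner x (Dp dx y)"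
  by (simp add: Dp_def Dm_def inner_diff inner_shift algebra_simps)

lemma inner_Dc: "inner (Dc dx x) y = - inner x (Dc dx y)"
  by (simp add: Dc_def inner_add inner_Dp inner_Dm field_simps)

lemma D3_skew: "inner (D3 dx x) x = 0"
proof -
  have "inner (D3 dx x) x = - inner x (D3 dx x)"
    by (simp add: inner_Dm inner_Dc inner_Dp)
  then show ?thesis by (simp add: inner_commute)
qed

lemma norm_Dm: "norm (Dm dx x) = norm (Dp dx x)"
  and maxnorm_Dm: "maxnorm (Dm dx x) = maxnorm (Dp dx x)"
proof -
  have "Dm dx x = shift (-1) (Dp dx x)"
    by (rule l2_eqI) (simp add: stencil_simps)
  then show "norm (Dm dx x) = norm (Dp dx x)" "maxnorm (Dm dx x) = maxnorm (Dp dx x)"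
    by simp_all
qed

lemma norm_Dc_le: "norm (Dc dx x) \<le> norm (Dp dx x)"
  using norm_triangle_ineq[of "Dp dx x" "Dm dx x"] by (simp add: Dc_def norm_Dm)

lemma maxnorm_Dc_le: "maxnorm (Dc dx x) \<le> maxnorm (Dp dx x)"
proof (rule maxnorm_le)
  fix j
  have "\<bar>coord (Dp dx x) j\<bar> \<le> maxnorm (Dp dx x)" "\<bar>coord (Dm dx x) j\<bar> \<le> maxnorm (Dp dx x)"
    using abs_coord_le_maxnorm maxnorm_Dm by metis+
  then show "\<bar>coord (Dc dx x) j\<bar> \<le> maxnorm (Dp dx x)"
    by (simp add: Dc_def)
qed

lemma norm_avg_le: "norm (avg x) \<le> norm x"
proof -
  have "norm (shift 1 x + x + shift (-1) x) \<le> norm (shift 1 x) + norm x + norm (shift (-1) x)"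
    by (meson add_mono norm_triangle_ineq norm_triangle_le order_refl)
  then show ?thesis by (simp add: avg_def)
qed

lemma norm_Dp_bound: "0 < dx \<Longrightarrow> norm (Dp dx x) \<le> 2 / dx * norm x"
  using norm_triangle_ineq4[of "shift 1 x" x]
  by (simp add: Dp_def divide_inverse_commute[symmetric] divide_right_mono)

text \<open>The central difference skips the middle point, hence loses only \<open>1 / dx\<close> instead of
  \<open>2 / dx\<close>.\<close>

lemma norm_Dc_bound:
  assumes "0 < dx"
  shows "norm (Dc dx x) \<le> 1 / dx * norm x"
proof -
  have "Dc dx x = (1 / (2 * dx)) *\<^sub>R (shift 1 x - shift (-1) x)"
    using assms by (auto intro!: l2_eqI simp: stencil_simps field_simps)
  then have "norm (Dc dx x) = norm (shift 1 x - shift (-1) x) / (2 * dx)"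
    using assms by simp
  also have "\<dots> \<le> (2 * norm x) / (2 * dx)"
    using assms norm_triangle_ineq4[of "shift 1 x" "shift (-1) x"] by (intro divide_right_mono) auto
  finally show ?thesis by simp
qed

lemma norm_D3_bound:
  assumes "0 < dx"
  shows "norm (D3 dx x) \<le> 2 / dx * (1 / dx * (2 / dx)) * norm x"
proof -
  have "norm (D3 dx x) \<le> 2 / dx * norm (Dc dx (Dp dx x))"
    unfolding norm_Dm using assms by (rule norm_Dp_bound)
  also have "\<dots> \<le> 2 / dx * (1 / dx * norm (Dp dx x))"
    using assms by (intro mult_left_mono norm_Dc_bound) auto
  also have "\<dots> \<le> 2 / dx * (1 / dx * (2 / dx * norm x))"
    using assms by (intro mult_left_mono norm_Dp_bound) auto
  finally show ?thesis by (simp add: mult.assoc)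
qed

section \<open>The discrete Sobolev inequality\<close>

lemma two_sided_telescope:
  fixes g :: "int \<Rightarrow> real"
  shows "2 * g j - g (j - int n) - g (j + int n) \<le> (\<Sum>i\<in>{j - int n..<j + int n}. \<bar>g (i + 1) - g i\<bar>)"
proof (induction n)
  case (Suc n)
  have "{j - int (Suc n)..<j + int (Suc n)}
      = insert (j - int (Suc n)) (insert (j + int n) {j - int n..<j + int n})"
    by auto
  then have "(\<Sum>i\<in>{j - int (Suc n)..<j + int (Suc n)}. \<bar>g (i + 1) - g i\<bar>)
      = \<bar>g (j - int n) - g (j - int (Suc n))\<bar> + \<bar>g (j + int (Suc n)) - g (j + int n)\<bar>
        + (\<Sum>i\<in>{j - int n..<j + int n}. \<bar>g (i + 1) - g i\<bar>)"
    by (simp add: algebra_simps)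
  then show ?case using Suc.IH by linarith
qed simp

lemma coord_tendsto_zero:
  fixes x :: "int l2"
  assumes "inj f"
  shows "(\<lambda>n::nat. (coord x (f n))\<^sup>2) \<longlonglongrightarrow> 0"
proof -
  have "(\<lambda>j. (coord x j)\<^sup>2) summable_on range f"
    by (rule summable_on_subset_banach[OF square_summable_coord]) simp
  then have "summable (\<lambda>n. (coord x (f n))\<^sup>2)"
    unfolding summable_on_reindex[OF assms] by (auto simp: o_def intro: summable_on_imp_summable)
  then show ?thesis by (rule summable_LIMSEQ_zero)
qed

text \<open>Telescoping \<open>x\<^sup>2\<close> towards the point from both sides gains a factor two over a one-sided sum:
  the increments \<open>(x\<^sub>i\<^sub>+\<^sub>1 - x\<^sub>i) (x\<^sub>i\<^sub>+\<^sub>1 + x\<^sub>i)\<close> over all of the grid, estimated by Cauchy-Schwarz, bound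
  \<open>2 x\<^sub>j\<^sup>2\<close>.\<close>

lemma coord_sq_le:
  assumes "0 < dx"
  shows "(coord x j)\<^sup>2 \<le> dx * (norm x * norm (Dp dx x))"
proof -
  define a where "a = shift 1 x - x"
  define b where "b = shift 1 x + x"
  have a: "norm a = dx * norm (Dp dx x)"
    using assms by (simp add: a_def Dp_def)
  have b: "norm b \<le> 2 * norm x"
    unfolding b_def by (rule order_trans[OF norm_triangle_ineq]) simp
  have sum: "(\<Sum>i\<in>F. \<bar>(coord x (i + 1))\<^sup>2 - (coord x i)\<^sup>2\<bar>) \<le> norm a * norm b" if "finite F" for F
  proof -
    have "(\<Sum>i\<in>F. \<bar>(coord x (i + 1))\<^sup>2 - (coord x i)\<^sup>2\<bar>) = (\<Sum>i\<in>F. \<bar>coord a i\<bar> * \<bar>coord b i\<bar>)"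
      by (simp add: a_def b_def abs_mult[symmetric] square_diff_square_factored power2_eq_square mult.commute)
    also have "\<dots> \<le> L2_set (coord a) F * L2_set (coord b) F"
      by (rule L2_set_mult_ineq)
    also have "\<dots> \<le> norm a * norm b"
      unfolding L2_set_def using that
      by (intro mult_mono) (auto intro!: real_le_lsqrt sum_nonneg sum_coord_sq_le)
    finally show ?thesis .
  qed
  \<comment> \<open>The end terms of the telescope vanish at infinity.\<close>
  have "2 * (coord x j)\<^sup>2 - 0 - 0 \<le> norm a * norm b"
  proof (rule tendsto_upperbound)
    show "(\<lambda>n. 2 * (coord x j)\<^sup>2 - (coord x (j - int n))\<^sup>2 - (coord x (j + int n))\<^sup>2)
        \<longlonglongrightarrow> 2 * (coord x j)\<^sup>2 - 0 - 0"
      by (intro tendsto_intros coord_tendsto_zero) (auto intro: injI)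
    show "\<forall>\<^sub>F n in sequentially.
        2 * (coord x j)\<^sup>2 - (coord x (j - int n))\<^sup>2 - (coord x (j + int n))\<^sup>2 \<le> norm a * norm b"
      using order_trans[OF two_sided_telescope[of "\<lambda>j. (coord x j)\<^sup>2"] sum] by simp
  qed simp
  also have "\<dots> \<le> (dx * norm (Dp dx x)) * (2 * norm x)"
    unfolding a using assms by (intro mult_left_mono b) auto
  finally show ?thesis by (simp add: algebra_simps)
qed

lemma maxnorm_sobolev:
  assumes "0 < dx"
  shows "maxnorm x \<le> sqrt dx * (norm x + norm (Dp dx x)) / 2"
proof (rule maxnorm_le)
  fix j
  define p q where "p = norm x" and "q = norm (Dp dx x)"
  have "4 * (p * q) \<le> (p + q)\<^sup>2"
    using sum_squares_ge_zero[of "p - q" 0] by (simp add: power2_eq_square algebra_simps)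
  then have "dx * (4 * (p * q)) \<le> dx * (p + q)\<^sup>2"
    using assms by (intro mult_left_mono) auto
  moreover have "(coord x j)\<^sup>2 \<le> dx * (p * q)"
    unfolding p_def q_def by (rule coord_sq_le[OF assms])
  ultimately have "4 * (coord x j)\<^sup>2 \<le> dx * (p + q)\<^sup>2"
    by linarith
  then have "\<bar>coord x j\<bar>\<^sup>2 \<le> (sqrt dx * (p + q) / 2)\<^sup>2"
    using assms by (simp add: power_mult_distrib power_divide)
  then show "\<bar>coord x j\<bar> \<le> sqrt dx * (norm x + norm (Dp dx x)) / 2"
    unfolding p_def q_def by (rule power2_le_imp_le) (use assms in simp)
qed

section \<open>The discrete third order Sobolev space is a Banach algebra\<close>

definition h3 :: "real \<Rightarrow> int l2 \<Rightarrow> real" where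
  "h3 dx x = sqrt dx *
     (norm x + norm (Dp dx x) + norm (Dp dx (Dm dx x)) + norm (D3 dx x))"

lemma h3norm_coord: "h3norm dx (coord x) = h3 dx x"
proof -
  have "l2norm dx (coord y) = sqrt dx * norm y" for y :: "int l2"
    by (simp add: l2norm_def norm_l2_sq[symmetric] real_sqrt_mult)
  from this[of x] this[of "Dp dx x"] this[of "Dp dx (Dm dx x)"] this[of "D3 dx x"]
  show ?thesis
    by (simp add: h3norm_def h3_def coord_Dp coord_Dm coord_Dc algebra_simps)
qed

lemma h3_nonneg: "0 < dx \<Longrightarrow> 0 \<le> h3 dx x"
  by (simp add: h3_def)

lemma norm_le_h3: "0 < dx \<Longrightarrow> sqrt dx * norm x \<le> h3 dx x"
  unfolding h3_def by (intro mult_left_mono) auto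

lemma h3_triangle:
  assumes "0 < dx"
  shows "h3 dx (x + y) \<le> h3 dx x + h3 dx y"
proof -
  have "norm (x + y) + norm (Dp dx x + Dp dx y) + norm (Dp dx (Dm dx x) + Dp dx (Dm dx y))
       + norm (D3 dx x + D3 dx y)
     \<le> (norm x + norm (Dp dx x) + norm (Dp dx (Dm dx x)) + norm (D3 dx x))
       + (norm y + norm (Dp dx y) + norm (Dp dx (Dm dx y)) + norm (D3 dx y))"
    using norm_triangle_ineq[of x y] norm_triangle_ineq[of "Dp dx x" "Dp dx y"]
      norm_triangle_ineq[of "Dp dx (Dm dx x)" "Dp dx (Dm dx y)"]
      norm_triangle_ineq[of "D3 dx x" "D3 dx y"] by linarith
  from mult_left_mono[OF this, of "sqrt dx"] show ?thesis
    using assms by (simp add: h3_def linear_add[OF operators_linear(1)] linear_add[OF operators_linear(2)]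
        linear_add[OF operators_linear(3)] distrib_left)
qed

lemma h3_scaleR: "h3 dx (c *\<^sub>R x) = \<bar>c\<bar> * h3 dx x"
  by (simp add: h3_def linear_scale[OF operators_linear(1)] linear_scale[OF operators_linear(2)]
        linear_scale[OF operators_linear(3)] algebra_simps)

lemma h3_le_of_norm_le:
  assumes "0 < dx" "norm x \<le> c * norm y" "norm (Dp dx x) \<le> c * norm (Dp dx y)"
    "norm (Dp dx (Dm dx x)) \<le> c * norm (Dp dx (Dm dx y))" "norm (D3 dx x) \<le> c * norm (D3 dx y)"
  shows "h3 dx x \<le> c * h3 dx y"
proof -
  have "norm x + norm (Dp dx x) + norm (Dp dx (Dm dx x)) + norm (D3 dx x)
      \<le> c * (norm y + norm (Dp dx y) + norm (Dp dx (Dm dx y)) + norm (D3 dx y))"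
    using assms by (simp add: distrib_left)
  from mult_left_mono[OF this, of "sqrt dx"] show ?thesis
    using assms(1) by (simp add: h3_def mult.left_commute)
qed

lemma h3_avg_le: "0 < dx \<Longrightarrow> h3 dx (avg x) \<le> h3 dx x"
  using h3_le_of_norm_le[of dx "avg x" 1 x]
  by (simp add: operators_commute(4-6)[symmetric] norm_avg_le)

lemma h3_Dc_le: "0 < dx \<Longrightarrow> h3 dx (Dc dx x) \<le> 1 / dx * h3 dx x"
  by (rule h3_le_of_norm_le)
    (auto simp only: operators_commute(2,3)[symmetric] intro: norm_Dc_bound)

text \<open>With \<open>norm_le_h3\<close>, the equivalence of the two norms for fixed \<open>\<Delta>x\<close>; only the existence of a
  constant matters, as it is used to pass to the limit and not in the estimates.\<close>

lemma h3_le_norm: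
  assumes "0 < dx"
  shows "\<exists>C. \<forall>x. h3 dx x \<le> C * norm x"
proof (intro exI allI)
  fix x
  have "norm (Dp dx (Dm dx x)) \<le> 2 / dx * (2 / dx * norm x)"
    by (rule order_trans[OF norm_Dp_bound mult_left_mono])
      (use assms norm_Dp_bound[of dx x] in \<open>auto simp: norm_Dm\<close>)
  then have "norm x + norm (Dp dx x) + norm (Dp dx (Dm dx x)) + norm (D3 dx x)
      \<le> norm x + 2 / dx * norm x + 2 / dx * (2 / dx * norm x) + 2 / dx * (1 / dx * (2 / dx)) * norm x"
    using norm_Dp_bound[OF assms, of x] norm_D3_bound[OF assms, of x] by linarith
  also have "\<dots> = (1 + 2 / dx + 2 / dx * (2 / dx) + 2 / dx * (1 / dx * (2 / dx))) * norm x"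
    by (simp add: algebra_simps)
  finally show "h3 dx x \<le> (sqrt dx * (1 + 2 / dx + 2 / dx * (2 / dx) + 2 / dx * (1 / dx * (2 / dx)))) * norm x"
    using mult_left_mono[of _ _ "sqrt dx"] assms by (simp add: h3_def mult.assoc)
qed

lemma norm_Dp_times:
  "norm (Dp dx (a * b)) \<le> maxnorm a * norm (Dp dx b) + maxnorm (Dp dx a) * norm b"
proof -
  have "Dp dx (a * b) = shift 1 a * Dp dx b + Dp dx a * b"
    by (rule l2_eqI) (simp add: stencil_simps diff_divide_distrib algebra_simps)
  then have "norm (Dp dx (a * b)) \<le> norm (shift 1 a * Dp dx b) + norm (Dp dx a * b)"
    by (simp add: norm_triangle_ineq)
  then show ?thesis
    using norm_times_le_left[of "shift 1 a" "Dp dx b"] norm_times_le_left[of "Dp dx a" b] by simp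
qed

lemma laplacian_times:
  "Dp dx (Dm dx (a * b)) = (a * Dp dx (Dm dx b) + b * Dp dx (Dm dx a))
     + (Dp dx a * Dp dx b + Dm dx a * Dm dx b)"
proof (rule l2_eqI)
  fix j
  have product_rule: "((ap * bp - a0 * b0) / d - (a0 * b0 - am * bm) / d) / d
      = (a0 * (((bp - b0) / d - (b0 - bm) / d) / d) + b0 * (((ap - a0) / d - (a0 - am) / d) / d))
        + ((ap - a0) / d * ((bp - b0) / d) + (a0 - am) / d * ((b0 - bm) / d))"
    for ap a0 am bp b0 bm d :: real
    by (cases "d = 0") (simp_all add: field_simps)
  show "coord (Dp dx (Dm dx (a * b))) j = coord ((a * Dp dx (Dm dx b) + b * Dp dx (Dm dx a))
     + (Dp dx a * Dp dx b + Dm dx a * Dm dx b)) j"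
    using product_rule by (simp add: stencil_simps)
qed

lemma norm_laplacian_times:
  "norm (Dp dx (Dm dx (a * b))) \<le> maxnorm a * norm (Dp dx (Dm dx b))
     + 2 * (maxnorm (Dp dx a) * norm (Dp dx b)) + maxnorm b * norm (Dp dx (Dm dx a))"
proof -
  have "norm (Dp dx (Dm dx (a * b))) = norm ((a * Dp dx (Dm dx b) + b * Dp dx (Dm dx a))
      + (Dp dx a * Dp dx b + Dm dx a * Dm dx b))"
    by (subst laplacian_times) (rule refl)
  also have "\<dots> \<le> (norm (a * Dp dx (Dm dx b)) + norm (b * Dp dx (Dm dx a)))
      + (norm (Dp dx a * Dp dx b) + norm (Dm dx a * Dm dx b))"
    by (intro norm_triangle_mono norm_triangle_ineq)
  finally show ?thesis
    using norm_times_le_left[of a "Dp dx (Dm dx b)"] norm_times_le_left[of b "Dp dx (Dm dx a)"]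
      norm_times_le_left[of "Dp dx a" "Dp dx b"] norm_times_le_left[of "Dm dx a" "Dm dx b"]
    by (simp add: norm_Dm maxnorm_Dm)
qed

lemma Dc_times: "Dc dx (x * y) = shift 1 x * Dc dx y + Dc dx x * shift (-1) y"
  by (rule l2_eqI) (simp add: stencil_simps add_divide_distrib diff_divide_distrib algebra_simps)

text \<open>Two forms of the Leibniz rule, because the maximum norm should never fall on a second
  difference. When \<open>y\<close> already is one, the difference of \<open>x\<close> is measured in the maximum norm; when
  \<open>x\<close> and \<open>y\<close> both are first differences, the undifferenced factor is.\<close>

lemma norm_Dc_times:
  shows "norm (Dc dx (x * y)) \<le> maxnorm x * norm (Dc dx y) + maxnorm (Dc dx x) * norm y"
    and "norm (Dc dx (x * y)) \<le> maxnorm x * norm (Dc dx y) + maxnorm y * norm (Dc dx x)"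
proof -
  have "norm (Dc dx (x * y)) \<le> norm (shift 1 x * Dc dx y) + norm (Dc dx x * shift (-1) y)"
    unfolding Dc_times by (rule norm_triangle_ineq)
  then show "norm (Dc dx (x * y)) \<le> maxnorm x * norm (Dc dx y) + maxnorm (Dc dx x) * norm y"
    and "norm (Dc dx (x * y)) \<le> maxnorm x * norm (Dc dx y) + maxnorm y * norm (Dc dx x)"
    using norm_times_le_left[of "shift 1 x" "Dc dx y"] norm_times_le_left[of "Dc dx x" "shift (-1) y"]
      norm_times_le_right[of "Dc dx x" "shift (-1) y"] by simp_all
qed

lemma D3_eq: "D3 dx x = Dc dx (Dp dx (Dm dx x))"
  by (simp add: operators_commute)

text \<open>In each term the factor in the maximum norm carries at most one difference, the number that
  the Sobolev inequality can absorb while staying within second order norms; the factor in the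
  square norm carries at most three.\<close>

lemma norm_D3_times:
  "norm (D3 dx (a * b)) \<le> maxnorm a * norm (D3 dx b) + 3 * (maxnorm (Dp dx a) * norm (Dp dx (Dm dx b)))
     + 3 * (maxnorm (Dp dx b) * norm (Dp dx (Dm dx a))) + maxnorm b * norm (D3 dx a)"
proof -
  have Dc_Dp: "norm (Dc dx (Dp dx x)) \<le> norm (Dp dx (Dm dx x))" for x
    using norm_Dc_le[of dx "Dp dx x"] by (simp add: norm_Dm[of dx "Dp dx x", symmetric] operators_commute)
  have Dc_Dm: "norm (Dc dx (Dm dx x)) \<le> norm (Dp dx (Dm dx x))" for x
    by (rule norm_Dc_le)
  have outer: "norm (Dc dx (x * Dp dx (Dm dx y)))
      \<le> maxnorm x * norm (D3 dx y) + maxnorm (Dp dx x) * norm (Dp dx (Dm dx y))" for x y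
    unfolding D3_eq
    by (rule order_trans[OF norm_Dc_times(1) add_left_mono])
      (intro mult_right_mono maxnorm_Dc_le norm_ge_zero)
  have inner: "norm (Dc dx (x * y)) \<le> maxnorm (Dp dx a) * norm (Dp dx (Dm dx b))
      + maxnorm (Dp dx b) * norm (Dp dx (Dm dx a))"
    if "x = Dp dx a \<and> y = Dp dx b \<or> x = Dm dx a \<and> y = Dm dx b" for x y
  proof -
    have "maxnorm x * norm (Dc dx y) \<le> maxnorm (Dp dx a) * norm (Dp dx (Dm dx b))"
      and "maxnorm y * norm (Dc dx x) \<le> maxnorm (Dp dx b) * norm (Dp dx (Dm dx a))"
      using that by (auto intro!: mult_left_mono maxnorm_nonneg Dc_Dp Dc_Dm simp: maxnorm_Dm)
    then show ?thesis using norm_Dc_times(2)[of dx x y] by linarith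
  qed
  have "norm (D3 dx (a * b)) = norm ((Dc dx (a * Dp dx (Dm dx b)) + Dc dx (b * Dp dx (Dm dx a)))
      + (Dc dx (Dp dx a * Dp dx b) + Dc dx (Dm dx a * Dm dx b)))"
    by (simp only: D3_eq laplacian_times linear_add[OF operators_linear(3)])
  also have "\<dots> \<le> (norm (Dc dx (a * Dp dx (Dm dx b))) + norm (Dc dx (b * Dp dx (Dm dx a))))
      + (norm (Dc dx (Dp dx a * Dp dx b)) + norm (Dc dx (Dm dx a * Dm dx b)))"
    by (intro norm_triangle_mono norm_triangle_ineq)
  finally show ?thesis
    using outer[of a b] outer[of b a] 
      inner[OF disjI1[OF conjI[OF refl refl]]] inner[OF disjI2[OF conjI[OF refl refl]]]
    by linarith
qed

text \<open>The Sobolev inequality bounds each of the maximum norms of \<open>a\<close>, \<open>D\<^sub>+a\<close>, \<open>b\<close>, \<open>D\<^sub>+b\<close> by half of the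
  \<open>h\<^sup>3\<close> norm. In the Leibniz rules, the norms multiplied by those of \<open>a\<close> add up to at most four times
  the \<open>h\<^sup>3\<close> norm of \<open>b\<close>, and conversely: this is the constant \<open>4 = 4/2 + 4/2\<close>.\<close>

theorem h3_times_le:
  assumes "0 < dx"
  shows "h3 dx (a * b) \<le> 4 * h3 dx a * h3 dx b"
proof -
  define N where "N x = norm x + norm (Dp dx x) + norm (Dp dx (Dm dx x)) + norm (D3 dx x)" for x
  define s where "s = sqrt dx"
  have s: "0 \<le> s" using assms by (simp add: s_def)
  have sup: "maxnorm x \<le> s * N x / 2" "maxnorm (Dp dx x) \<le> s * N x / 2" for x
  proof -
    have "maxnorm x \<le> s * (norm x + norm (Dp dx x)) / 2"
      unfolding s_def by (rule maxnorm_sobolev[OF assms])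
    also have "\<dots> \<le> s * N x / 2"
      unfolding N_def using s by (intro divide_right_mono mult_left_mono) auto
    finally show "maxnorm x \<le> s * N x / 2" .
    have "maxnorm (Dp dx x) = maxnorm (Dm dx x)" by (simp add: maxnorm_Dm)
    also have "\<dots> \<le> s * (norm (Dm dx x) + norm (Dp dx (Dm dx x))) / 2"
      unfolding s_def by (rule maxnorm_sobolev[OF assms])
    also have "\<dots> \<le> s * N x / 2"
      unfolding N_def norm_Dm[of dx x] using s by (intro divide_right_mono mult_left_mono) auto
    finally show "maxnorm (Dp dx x) \<le> s * N x / 2" .
  qed
  have a: "maxnorm a * t \<le> s * N a / 2 * t" "maxnorm (Dp dx a) * t \<le> s * N a / 2 * t"
    and b: "maxnorm b * t \<le> s * N b / 2 * t" "maxnorm (Dp dx b) * t \<le> s * N b / 2 * t"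
    if "0 \<le> t" for t
    using that by (rule mult_right_mono[OF sup(1)] mult_right_mono[OF sup(2)])+
  have "N (a * b) \<le> s * N a / 2 * (2 * norm b + 3 * norm (Dp dx b) + 4 * norm (Dp dx (Dm dx b)) + norm (D3 dx b))
      + s * N b / 2 * (4 * norm (Dp dx (Dm dx a)) + norm (D3 dx a))"
    using norm_times_le_left[of a b] norm_Dp_times[of dx a b] norm_laplacian_times[of dx a b]
      norm_D3_times[of dx a b] a[of "norm b"] a[of "norm (Dp dx b)"] a[of "norm (Dp dx (Dm dx b))"]
      a[of "norm (D3 dx b)"] b[of "norm (Dp dx (Dm dx a))"] b[of "norm (D3 dx a)"]
    unfolding N_def[of "a * b"] by (simp add: algebra_simps)
  also have "\<dots> \<le> s * N a / 2 * (4 * N b) + s * N b / 2 * (4 * N a)"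
    unfolding N_def using s by (intro add_mono mult_left_mono) auto
  finally have "N (a * b) \<le> 4 * s * N a * N b" by (simp add: algebra_simps)
  from mult_left_mono[OF this s] show ?thesis
    by (simp add: h3_def N_def s_def algebra_simps)
qed

section \<open>The iteration as a contraction\<close>

definition burgers :: "real \<Rightarrow> int l2 \<Rightarrow> int l2" where
  "burgers dx x = avg x * Dc dx x"

definition mid :: "int l2 \<Rightarrow> int l2 \<Rightarrow> int l2" where
  "mid x y = (x + y) /\<^sub>R 2"

lemma coord_burgers: "coord (burgers dx x) = Gop dx (coord x)"
  by (auto simp: burgers_def Gop_def coord_avg coord_Dc)

lemma coord_mid: "coord (mid x y) = half (coord x) (coord y)"
  by (auto simp: mid_def half_def)

lemma h3_mid_le: "0 < dx \<Longrightarrow> h3 dx (mid x y) \<le> (h3 dx x + h3 dx y) / 2"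
  using h3_triangle[of dx x y] by (simp add: mid_def h3_scaleR)

text \<open>The difference of the two quadratic terms splits into two products in which one factor comes
  from \<open>x - y\<close>, so the algebra property applies to each of them.\<close>

lemma h3_burgers_diff_le:
  assumes "0 < dx"
  shows "h3 dx (burgers dx x - burgers dx y) \<le> 4 / dx * (h3 dx x + h3 dx y) * h3 dx (x - y)"
proof -
  have bilinear: "h3 dx (avg p * Dc dx q) \<le> 4 * h3 dx p * (1 / dx * h3 dx q)" for p q
    by (rule order_trans[OF h3_times_le[OF assms] mult_mono])
      (use assms in \<open>auto intro!: h3_avg_le h3_Dc_le[simplified] h3_nonneg\<close>)
  have "burgers dx x - burgers dx y = avg (x - y) * Dc dx x + avg y * Dc dx (x - y)"
    by (simp add: burgers_def linear_diff[OF operators_linear(3)] linear_diff[OF operators_linear(4)]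
        algebra_simps)
  then have "h3 dx (burgers dx x - burgers dx y)
      \<le> h3 dx (avg (x - y) * Dc dx x) + h3 dx (avg y * Dc dx (x - y))"
    using h3_triangle[OF assms] by simp
  also have "\<dots> \<le> 4 * h3 dx (x - y) * (1 / dx * h3 dx x) + 4 * h3 dx y * (1 / dx * h3 dx (x - y))"
    by (intro add_mono bilinear)
  finally show ?thesis by (simp add: algebra_simps)
qed

lemma h3_burgers_le: "0 < dx \<Longrightarrow> h3 dx (burgers dx x) \<le> 4 / dx * h3 dx x * h3 dx x"
  using h3_burgers_diff_le[of dx x 0]
  by (simp add: burgers_def linear_0[OF operators_linear(4)] h3_def linear_0[OF operators_linear(1)]
      linear_0[OF operators_linear(2)] linear_0[OF operators_linear(3)])

lemma scaled_D3_skew: "linear (\<lambda>x. a *\<^sub>R D3 dx x)" "inner (a *\<^sub>R D3 dx x) x = 0"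
  by (simp_all add: linear_compose_scale_right linear_D3 D3_skew)

text \<open>Applying a difference to the equation yields the same equation for the differences, because
  all the operators are polynomials in the shift and commute; so each of the four parts of the
  norm obeys its own energy estimate.\<close>

lemma h3_energy_estimate:
  assumes "0 < dx" and eq: "w + a *\<^sub>R D3 dx w = u - a *\<^sub>R D3 dx u - f"
  shows "h3 dx w \<le> h3 dx u + h3 dx f"
proof -
  have energy: "norm (S w) \<le> norm (S u) + norm (S f)"
    if S: "linear S" "\<And>x. S (D3 dx x) = D3 dx (S x)" for S
  proof (rule skew_energy_estimate[OF scaled_D3_skew])
    have "S (w + a *\<^sub>R D3 dx w) = S (u - a *\<^sub>R D3 dx u - f)"
      by (simp only: eq)
    then show "S w + a *\<^sub>R D3 dx (S w) = S u - a *\<^sub>R D3 dx (S u) - S f"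
      by (simp only: linear_add[OF S(1)] linear_diff[OF S(1)] linear_scale[OF S(1)] S(2))
  qed
  have commute: "Dp dx (D3 dx x) = D3 dx (Dp dx x)" "Dm dx (D3 dx x) = D3 dx (Dm dx x)"
    "Dc dx (D3 dx x) = D3 dx (Dc dx x)" for x
    by (simp_all add: operators_commute)
  have "norm (Dp dx (Dm dx w)) \<le> norm (Dp dx (Dm dx u)) + norm (Dp dx (Dm dx f))"
    using energy[of "\<lambda>x. Dp dx (Dm dx x)"] linear_compose[OF operators_linear(2,1)]
    by (simp add: o_def commute)
  moreover have "norm (D3 dx w) \<le> norm (D3 dx u) + norm (D3 dx f)"
    using energy[OF linear_D3] by simp
  moreover have "norm (Dp dx w) \<le> norm (Dp dx u) + norm (Dp dx f)"
    using energy[OF operators_linear(1) commute(1)] .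
  moreover have "norm w \<le> norm u + norm f"
    using energy[of "\<lambda>x. x"] by (simp add: linear_id[unfolded id_def])
  ultimately have "norm w + norm (Dp dx w) + norm (Dp dx (Dm dx w)) + norm (D3 dx w)
      \<le> (norm u + norm (Dp dx u) + norm (Dp dx (Dm dx u)) + norm (D3 dx u))
       + (norm f + norm (Dp dx f) + norm (Dp dx (Dm dx f)) + norm (D3 dx f))"
    by linarith
  from mult_left_mono[OF this, of "sqrt dx"] assms(1) show ?thesis
    by (simp add: h3_def distrib_left)
qed

definition step :: "real \<Rightarrow> real \<Rightarrow> int l2 \<Rightarrow> int l2 \<Rightarrow> int l2" where
  "step dx dt u y = (THE w. w + (dt / 2) *\<^sub>R D3 dx w
     = u - (dt / 2) *\<^sub>R D3 dx u - dt *\<^sub>R burgers dx (mid u y))"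

lemma step_iff:
  assumes "0 < dx"
  shows "w = step dx dt u y \<longleftrightarrow>
    w + (dt / 2) *\<^sub>R D3 dx w = u - (dt / 2) *\<^sub>R D3 dx u - dt *\<^sub>R burgers dx (mid u y)"
proof -
  have "norm ((dt / 2) *\<^sub>R D3 dx x) \<le> (\<bar>dt / 2\<bar> * (2 / dx * (1 / dx * (2 / dx)))) * norm x" for x
    unfolding norm_scaleR mult.assoc
    using norm_D3_bound[OF assms, of x] by (intro mult_left_mono) (simp_all add: mult.assoc)
  from skew_perturbation_bijective[OF scaled_D3_skew this]
  have "\<exists>!w. w + (dt / 2) *\<^sub>R D3 dx w = u - (dt / 2) *\<^sub>R D3 dx u - dt *\<^sub>R burgers dx (mid u y)" .
  from theI'[OF this] this show ?thesis
    unfolding step_def by blast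
qed

lemma step_iff_coord:
  assumes "0 < dx"
  shows "w = step dx dt u y \<longleftrightarrow> (\<forall>j. coord w j = coord u j
      - dt * Gop dx (half (coord u) (coord y)) j
      - dt * Dminus dx (Dcent dx (Dplus dx (half (coord u) (coord w)))) j)"
proof -
  have D3_mid: "D3 dx (mid u w) = (D3 dx u + D3 dx w) /\<^sub>R 2"
    by (simp add: mid_def linear_scale[OF linear_D3] linear_add[OF linear_D3])
  have "w = step dx dt u y
      \<longleftrightarrow> w = u - dt *\<^sub>R burgers dx (mid u y) - dt *\<^sub>R D3 dx (mid u w)"
    unfolding step_iff[OF assms] D3_mid by (auto simp: algebra_simps)
  also have "\<dots> \<longleftrightarrow> (\<forall>j. coord w j = coord (u - dt *\<^sub>R burgers dx (mid u y) - dt *\<^sub>R D3 dx (mid u w)) j)"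
    by (metis l2_eqI)
  finally show ?thesis
    by (simp add: coord_burgers coord_mid coord_Dp coord_Dm coord_Dc)
qed

lemma iterates_iff:
  assumes "0 < dx"
  shows "iterates dx dt (coord u) w \<longleftrightarrow> w = (\<lambda>l. coord ((step dx dt u ^^ l) u))"
proof
  assume it: "iterates dx dt (coord u) w"
  define x where "x l = l2_of (w l)" for l
  have w: "w l = coord (x l)" for l
    using it by (simp add: iterates_def x_def ell2_def coord_l2_of)
  have "x 0 = u"
    using it by (simp add: iterates_def x_def coord_inverse)
  moreover have "x (Suc l) = step dx dt u (x l)" for l
    unfolding step_iff_coord[OF assms] using it by (simp add: iterates_def w)
  ultimately have "x l = (step dx dt u ^^ l) u" for l
    by (induction l) simp_all
  then show "w = (\<lambda>l. coord ((step dx dt u ^^ l) u))"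
    by (simp add: fun_eq_iff w)
next
  assume w: "w = (\<lambda>l. coord ((step dx dt u ^^ l) u))"
  show "iterates dx dt (coord u) w"
    using step_iff_coord[OF assms, THEN iffD1, OF refl]
    by (simp add: iterates_def w ell2_def square_summable_coord)
qed

lemma h3_step_le:
  assumes "0 < dx" "0 < dt" and cfl: "dt / dx * h3 dx u \<le> 1 / 12" and y: "h3 dx y \<le> 3 * h3 dx u"
  shows "h3 dx (step dx dt u y) \<le> 3 * h3 dx u"
proof -
  define Z where "Z = h3 dx u"
  have Z: "0 \<le> Z" unfolding Z_def by (rule h3_nonneg[OF assms(1)])
  have mid: "h3 dx (mid u y) \<le> 2 * Z"
    using h3_mid_le[OF assms(1), of u y] y by (simp add: Z_def)
  have "h3 dx (dt *\<^sub>R burgers dx (mid u y)) \<le> dt * (4 / dx * (2 * Z) * (2 * Z))"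
    unfolding h3_scaleR abs_of_pos[OF assms(2)]
  proof (rule mult_left_mono[OF order_trans[OF h3_burgers_le[OF assms(1)]]])
    show "4 / dx * h3 dx (mid u y) * h3 dx (mid u y) \<le> 4 / dx * (2 * Z) * (2 * Z)"
      using assms(1) mid Z by (intro mult_mono order_refl) (auto intro: h3_nonneg)
  qed (use assms in simp)
  also have "\<dots> = 16 * (dt / dx * Z) * Z" by simp
  also have "\<dots> \<le> 16 * (1 / 12) * Z"
    using cfl Z unfolding Z_def by (intro mult_right_mono mult_left_mono) auto
  finally have "h3 dx (dt *\<^sub>R burgers dx (mid u y)) \<le> 2 * Z" using Z by simp
  moreover have "h3 dx (step dx dt u y) \<le> Z + h3 dx (dt *\<^sub>R burgers dx (mid u y))"
    unfolding Z_def by (rule h3_energy_estimate[OF assms(1) step_iff[OF assms(1), THEN iffD1, OF refl]])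
  ultimately show ?thesis by (simp add: Z_def)
qed

lemma h3_step_diff_le:
  assumes "0 < dx" "0 < dt" and cfl: "dt / dx * h3 dx u \<le> 1 / 12"
    and y: "h3 dx y \<le> 3 * h3 dx u" and z: "h3 dx z \<le> 3 * h3 dx u"
  shows "h3 dx (step dx dt u y - step dx dt u z) \<le> 2 / 3 * h3 dx (y - z)"
proof -
  define Z where "Z = h3 dx u"
  have Z: "0 \<le> Z" unfolding Z_def by (rule h3_nonneg[OF assms(1)])
  define f where "f = dt *\<^sub>R (burgers dx (mid u y) - burgers dx (mid u z))"
  have mid: "h3 dx (mid u y) + h3 dx (mid u z) \<le> 4 * Z"
    using h3_mid_le[OF assms(1), of u y] h3_mid_le[OF assms(1), of u z] y z by (simp add: Z_def)
  have mid_diff: "mid u y - mid u z = (1 / 2) *\<^sub>R (y - z)"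
    by (simp add: mid_def algebra_simps)
  have "h3 dx f \<le> dt * (4 / dx * (4 * Z) * (1 / 2 * h3 dx (y - z)))"
    unfolding f_def h3_scaleR abs_of_pos[OF assms(2)]
  proof (rule mult_left_mono[OF order_trans[OF h3_burgers_diff_le[OF assms(1)]]])
    show "4 / dx * (h3 dx (mid u y) + h3 dx (mid u z)) * h3 dx (mid u y - mid u z)
        \<le> 4 / dx * (4 * Z) * (1 / 2 * h3 dx (y - z))"
      unfolding mid_diff h3_scaleR
      using assms(1) mid Z h3_nonneg[OF assms(1), of "y - z"]
      by (intro mult_mono order_refl) (auto intro!: add_nonneg_nonneg h3_nonneg)
  qed (use assms in simp)
  also have "\<dots> = 8 * (dt / dx * Z) * h3 dx (y - z)" by simp
  also have "\<dots> \<le> 8 * (1 / 12) * h3 dx (y - z)"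
    using cfl h3_nonneg[OF assms(1), of "y - z"] unfolding Z_def
    by (intro mult_right_mono mult_left_mono) auto
  finally have f: "h3 dx f \<le> 2 / 3 * h3 dx (y - z)" by simp
  have "(step dx dt u y - step dx dt u z) + (dt / 2) *\<^sub>R D3 dx (step dx dt u y - step dx dt u z)
      = (step dx dt u y + (dt / 2) *\<^sub>R D3 dx (step dx dt u y))
        - (step dx dt u z + (dt / 2) *\<^sub>R D3 dx (step dx dt u z))"
    by (simp add: linear_diff[OF linear_D3] algebra_simps)
  also have "\<dots> = 0 - (dt / 2) *\<^sub>R D3 dx 0 - f"
    unfolding step_iff[OF assms(1), THEN iffD1, OF refl]
    by (simp add: f_def linear_0[OF linear_D3] scaleR_diff_right)
  finally have "(step dx dt u y - step dx dt u z) + (dt / 2) *\<^sub>R D3 dx (step dx dt u y - step dx dt u z)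
      = 0 - (dt / 2) *\<^sub>R D3 dx 0 - f" .
  from h3_energy_estimate[OF assms(1) this]
  have "h3 dx (step dx dt u y - step dx dt u z) \<le> h3 dx 0 + h3 dx f" .
  also have "h3 dx 0 = 0"
    using h3_scaleR[of dx 0 0] by simp
  finally show ?thesis using f by simp
qed

lemma convergent_of_geometric_steps:
  fixes x :: "nat \<Rightarrow> 'a::banach"
  assumes "\<And>n. norm (x (Suc n) - x n) \<le> C * q ^ n" "\<bar>q\<bar> < 1"
  shows "convergent x"
proof -
  have "summable (\<lambda>n. x (Suc n) - x n)"
    by (rule summable_comparison_test'[of "\<lambda>n. C * q ^ n" 0])
      (use assms in \<open>auto intro: summable_mult summable_geometric\<close>)
  then have "convergent (\<lambda>n. \<Sum>i<n. x (Suc i) - x i)"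
    by (simp add: summable_iff_convergent)
  then have "convergent (\<lambda>n. x n - x 0)"
    by (simp add: sum_lessThan_telescope)
  then show ?thesis
    using convergent_diff[OF _ convergent_const[of "- x 0"]] by fastforce
qed

lemma coord_tendsto:
  assumes "x \<longlonglongrightarrow> y"
  shows "(\<lambda>n. coord (x n) j) \<longlonglongrightarrow> coord y j"
proof (rule metric_tendsto_imp_tendsto[OF assms])
  show "\<forall>\<^sub>F n in sequentially. dist (coord (x n) j) (coord y j) \<le> dist (x n) y"
    using abs_coord_le_norm[of "x n - y" j for n] by (simp add: dist_norm)
qed

text \<open>The estimates hold in the \<open>h\<^sup>3\<close> norm, while completeness is available in the plain norm; hence
  the fixed point is built from geometrically decreasing increments, which pass from one norm
  to the other up to a constant, and not by a direct appeal to the contraction principle.\<close>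

theorem step_iteration_converges:
  fixes u :: "int l2"
  assumes "0 < dx" "0 < dt" and cfl: "dt / dx * h3 dx u \<le> 1 / 12"
  shows "\<exists>v. step dx dt u v = v \<and> (\<lambda>l. h3 dx ((step dx dt u ^^ l) u - v)) \<longlonglongrightarrow> 0
    \<and> h3 dx v \<le> 3 * h3 dx u"
proof -
  define x where "x l = (step dx dt u ^^ l) u" for l
  have x_Suc: "x (Suc l) = step dx dt u (x l)" for l
    by (simp add: x_def)
  have ball: "h3 dx (x l) \<le> 3 * h3 dx u" for l
  proof (induction l)
    case 0
    show ?case using h3_nonneg[OF assms(1), of u] by (simp add: x_def)
  next
    case (Suc l)
    then show ?case unfolding x_Suc by (rule h3_step_le[OF assms])
  qed
  define C where "C = h3 dx (x 1 - x 0)"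
  have geometric: "h3 dx (x (Suc l) - x l) \<le> C * (2 / 3) ^ l" for l
  proof (induction l)
    case (Suc l)
    have "h3 dx (x (Suc (Suc l)) - x (Suc l)) \<le> 2 / 3 * h3 dx (x (Suc l) - x l)"
      unfolding x_Suc[of "Suc l"] x_Suc[of l]
      by (rule h3_step_diff_le[OF assms]) (simp_all only: ball x_Suc[symmetric])
    also have "\<dots> \<le> 2 / 3 * (C * (2 / 3) ^ l)"
      by (rule mult_left_mono[OF Suc.IH]) simp
    finally show ?case by simp
  qed (simp add: C_def)
  have "norm (x (Suc l) - x l) \<le> (C / sqrt dx) * (2 / 3) ^ l" for l
    using order_trans[OF norm_le_h3[OF assms(1)] geometric, of l] assms(1)
    by (simp add: field_simps)
  then have "convergent x"
    by (rule convergent_of_geometric_steps) simp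
  then obtain v where v: "x \<longlonglongrightarrow> v"
    by (auto simp: convergent_def)
  have "coord v j = coord u j - dt * Gop dx (half (coord u) (coord v)) j
      - dt * Dminus dx (Dcent dx (Dplus dx (half (coord u) (coord v)))) j" for j
  proof (rule LIMSEQ_unique)
    show "(\<lambda>l. coord (x (Suc l)) j) \<longlonglongrightarrow> coord v j"
      by (rule LIMSEQ_Suc[OF coord_tendsto[OF v]])
    have "(\<lambda>l. coord u j - dt * Gop dx (half (coord u) (coord (x l))) j
        - dt * Dminus dx (Dcent dx (Dplus dx (half (coord u) (coord (x (Suc l)))))) j)
      \<longlonglongrightarrow> coord u j - dt * Gop dx (half (coord u) (coord v)) j
        - dt * Dminus dx (Dcent dx (Dplus dx (half (coord u) (coord v)))) j"
      unfolding Gop_def tilde_def Dminus_def Dcent_def Dplus_def half_def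
      by (intro tendsto_intros coord_tendsto[OF v] LIMSEQ_Suc[OF coord_tendsto[OF v]])
        (use assms(1) in simp_all)
    then show "(\<lambda>l. coord (x (Suc l)) j) \<longlonglongrightarrow> coord u j
        - dt * Gop dx (half (coord u) (coord v)) j
        - dt * Dminus dx (Dcent dx (Dplus dx (half (coord u) (coord v)))) j"
      using step_iff_coord[OF assms(1), THEN iffD1, OF x_Suc] by simp
  qed
  then have "step dx dt u v = v"
    by (intro sym[OF step_iff_coord[OF assms(1), THEN iffD2]] allI)
  moreover obtain M where M: "\<And>y. h3 dx y \<le> M * norm y"
    using h3_le_norm[OF assms(1)] by blast
  have lim: "(\<lambda>l. h3 dx (x l - v)) \<longlonglongrightarrow> 0"
  proof (rule tendsto_sandwich[OF _ _ tendsto_const])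
    show "(\<lambda>l. M * norm (x l - v)) \<longlonglongrightarrow> 0"
      using v by (intro tendsto_mult_right_zero tendsto_norm_zero) (simp add: LIM_zero)
  qed (simp_all add: M h3_nonneg[OF assms(1)])
  moreover have "h3 dx v \<le> 3 * h3 dx u + 0"
  proof (rule tendsto_lowerbound)
    show "(\<lambda>l. 3 * h3 dx u + h3 dx (x l - v)) \<longlonglongrightarrow> 3 * h3 dx u + 0"
      by (intro tendsto_intros lim)
    have "h3 dx v \<le> 3 * h3 dx u + h3 dx (x l - v)" for l
      using h3_triangle[OF assms(1), of "x l" "- (x l - v)"] h3_scaleR[of dx "-1" "x l - v"] ball[of l]
      by simp
    then show "\<forall>\<^sub>F l in sequentially. h3 dx v \<le> 3 * h3 dx u + h3 dx (x l - v)" by simp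
  qed simp
  ultimately show ?thesis unfolding x_def by (intro exI[of _ v]) simp
qed

theorem lemma3p1:
  fixes dx dt L K :: real and u :: "int \<Rightarrow> real"
  assumes "dx > 0" and "dt > 0"
    and "0 < L" and "L < 1"
    and "K = (4 - L) / (1 - L)"
    and "u \<in> ell2"
    and "h3norm dx u \<noteq> 0 \<longrightarrow> dt / dx \<le> L / (K * h3norm dx u)"
  shows "(\<exists>!w. iterates dx dt u w) \<and>
    (\<exists>u'\<in>ell2. solves_scheme dx dt u u' \<and>
       (\<forall>w. iterates dx dt u w \<longrightarrow>
          (\<lambda>l. h3norm dx (\<lambda>j. w l j - u' j)) \<longlonglongrightarrow> 0) \<and>
       h3norm dx u' \<le> K * h3norm dx u)"
proof -
  define U where "U = l2_of u"
  have u: "u = coord U"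
    using assms(6) by (simp add: U_def ell2_def coord_l2_of)
  have K: "3 \<le> K"
    unfolding assms(5) using assms(3,4) by (simp add: field_simps)
  \<comment> \<open>The left side is at most \<open>3\<close>, its value at \<open>L = 1/2\<close>, and the right side exceeds \<open>3\<close>.\<close>
  have "12 * (L * (1 - L)) \<le> 4 - L"
  proof -
    have "12 * (L * (1 - L)) = 3 - 3 * (1 - 2 * L)\<^sup>2"
      by (simp add: power2_eq_square algebra_simps)
    then show ?thesis using assms(4) zero_le_power2[of "1 - 2 * L"] by linarith
  qed
  then have LK: "L / K \<le> 1 / 12"
    unfolding assms(5) using assms(3,4) by (simp add: divide_le_eq)
  have cfl: "dt / dx * h3 dx U \<le> 1 / 12"
  proof (cases "h3 dx U = 0")
    case False
    then have pos: "0 < h3 dx U"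
      using h3_nonneg[OF assms(1), of U] by simp
    have "dt / dx * h3 dx U \<le> L / (K * h3 dx U) * h3 dx U"
      using assms(7) False pos by (intro mult_right_mono) (auto simp: u h3norm_coord)
    also have "\<dots> = L / K" using pos by simp
    also note LK
    finally show ?thesis .
  qed simp
  obtain v where v: "step dx dt U v = v" "(\<lambda>l. h3 dx ((step dx dt U ^^ l) U - v)) \<longlonglongrightarrow> 0"
    "h3 dx v \<le> 3 * h3 dx U"
    using step_iteration_converges[OF assms(1,2) cfl] by blast
  have diff: "(\<lambda>j. coord x j - coord v j) = coord (x - v)" for x
    by auto
  have "solves_scheme dx dt u (coord v)"
    using step_iff_coord[OF assms(1), of v dt U v] v(1)
    by (simp add: solves_scheme_def u Gop_def)
  moreover have "h3norm dx (coord v) \<le> K * h3norm dx u"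
    using order_trans[OF v(3) mult_right_mono[OF K h3_nonneg[OF assms(1)]]]
    by (simp add: u h3norm_coord)
  moreover have "coord v \<in> ell2"
    by (simp add: ell2_def square_summable_coord)
  ultimately show ?thesis
    unfolding u iterates_iff[OF assms(1)] using v(2) by (auto simp: diff h3norm_coord)
qed

end
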